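(* Let $\mathcal{F}$ be a set of CSP instances, all with the same variable set $X$ and the same domain $D$, which is closed under renaming. Let $\omega$ be a unitary and instance independent weight generator and, for $F\in\mathcal{F}$, let $w_F(\sigma,x)=\omega(x,\sigma(x),A_F(\sigma,x))$ for $\sigma\in\mathcal{S}(F)$, $x\in X$. Let $\prec$ be an instance independent orientation. Then $$\sum_{F\in\mathcal{F}}|\mathcal{M}_{\prec}(F)|=\gamma(\mathcal{F}).$$
   Context: A CSP instance is a triple $F=\langle X,D,C\rangle$ with $X$ a finite set of variables, $D$ a finite domain of values, and $C$ a set of constraints; a constraint is a pair $\langle (x_1,\dots,x_k),R\rangle$ with $(x_1,\dots,x_k)\in X^k$, $R\subseteq D^k$, for some integer $k$. A valuation is a map $v\in D^X$; it satisfies the constraint iff $(v(x_1),\dots,v(x_k))\in R$. A solution of $F$ is a valuation satisfying all constraints; $\mathcal{S}(F)$ is the set of solutions. Two solutions of $F$ are $x$-adjacent if they agree on all variables other than $x$ (each solution is $x$-adjacent to itself). $A_F(\sigma,x)$ is the set of values $\tau(x)$ over all solutions $\tau$ of $F$ that are $x$-adjacent to $\sigma$. An instance independent weight generator is a function $\omega:X\times D\times\mathcal{P}(D)\to\mathbb{R}_{\ge0}$ (not depending on $F$); it is unitary iff $\sum_{a\in\Delta}\omega(x,a,\Delta)=1$ for all $x\in X$ and all nonempty $\Delta\subseteq D$. The weight of an instance is $\gamma(F)=\sum_{\sigma\in\mathcal{S}(F)}\prod_{x\in X}w_F(\sigma,x)$, and $\gamma(\mathcal{F})=\sum_{F\in\mathcal{F}}\gamma(F)$.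 Sums over $\mathcal{F}$ are sums of nonnegative terms, taken in $[0,+\infty]$. A renaming is a family $\Pi=(\pi_x)_{x\in X}$ of permutations of $D$. $\Pi(F)$ is the instance obtained from $F$ by replacing every value $a$ occurring for variable $x$ by $\pi_x(a)$, i.e. each constraint $\langle(x_1,\dots,x_k),R\rangle$ is replaced by $\langle(x_1,\dots,x_k),\{(\pi_{x_1}(a_1),\dots,\pi_{x_k}(a_k)):(a_1,\dots,a_k)\in R\}\rangle$. $\mathcal{F}$ is closed under renaming if $F\in\mathcal{F}$ implies $\Pi(F)\in\mathcal{F}$ for every renaming $\Pi$. An instance independent orientation $\prec$ is given by a total strict order $<_x$ on $D$ for each $x\in X$ (not depending on $F$): for solutions $\sigma,\tau$ of an instance $F$, $\sigma\prec\tau$ iff for some $x\in X$ they are $x$-adjacent and $\sigma(x)<_x\tau(x)$. $\mathcal{M}_{\prec}(F)$ is the set of solutions $\sigma$ of $F$ for which no solution $\tau$ of $F$ satisfies $\tau\prec\sigma$. *)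

theory Defs
  imports "HOL-Analysis.Infinite_Sum" "HOL-Library.Extended_Nonnegative_Real"
    "HOL-Library.FuncSet" "HOL-Combinatorics.Permutations"
begin

text \<open>A constraint is a scope (a tuple of variables, as a list) with a relation
  (a set of tuples of values, as lists of the same length).\<close>

type_synonym ('x, 'd) constraint = "'x list \<times> 'd list set"

record ('x, 'd) csp =
  csp_vars :: "'x set"
  csp_dom  :: "'d set"
  csp_cons :: "('x, 'd) constraint set"

definition wf_constraint :: "'x set \<Rightarrow> 'd set \<Rightarrow> ('x, 'd) constraint \<Rightarrow> bool" where
  "wf_constraint X D c \<longleftrightarrow>
     set (fst c) \<subseteq> X \<and> (\<forall>as\<in>snd c. length as = length (fst c) \<and> set as \<subseteq> D)"

text \<open>The set of constraints may be infinite, and constraints of arity 0 are allowed.\<close>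

definition csp_instance :: "('x, 'd) csp \<Rightarrow> bool" where
  "csp_instance F \<longleftrightarrow> finite (csp_vars F) \<and> finite (csp_dom F) \<and>
     (\<forall>c\<in>csp_cons F. wf_constraint (csp_vars F) (csp_dom F) c)"

text \<open>Valuations are extensional functions (undefined outside the variable set), so that
  each map from the variables to the domain is counted exactly once.\<close>

definition valuations :: "('x, 'd) csp \<Rightarrow> ('x \<Rightarrow> 'd) set" where
  "valuations F = csp_vars F \<rightarrow>\<^sub>E csp_dom F"

definition satisfies :: "('x \<Rightarrow> 'd) \<Rightarrow> ('x, 'd) constraint \<Rightarrow> bool" where
  "satisfies v c \<longleftrightarrow> map v (fst c) \<in> snd c"

definition solutions :: "('x, 'd) csp \<Rightarrow> ('x \<Rightarrow> 'd) set" where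
  "solutions F = {v \<in> valuations F. \<forall>c\<in>csp_cons F. satisfies v c}"

definition adjacent :: "('x, 'd) csp \<Rightarrow> 'x \<Rightarrow> ('x \<Rightarrow> 'd) \<Rightarrow> ('x \<Rightarrow> 'd) \<Rightarrow> bool" where
  "adjacent F x \<sigma> \<tau> \<longleftrightarrow> \<sigma> \<in> solutions F \<and> \<tau> \<in> solutions F \<and>
     (\<forall>y\<in>csp_vars F - {x}. \<sigma> y = \<tau> y)"

definition available_values :: "('x, 'd) csp \<Rightarrow> ('x \<Rightarrow> 'd) \<Rightarrow> 'x \<Rightarrow> 'd set" where
  "available_values F \<sigma> x = {\<tau> x | \<tau>. adjacent F x \<sigma> \<tau>}"

definition weight_generator :: "'x set \<Rightarrow> 'd set \<Rightarrow> ('x \<Rightarrow> 'd \<Rightarrow> 'd set \<Rightarrow> real) \<Rightarrow> bool" where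
  "weight_generator X D \<omega> \<longleftrightarrow> (\<forall>x\<in>X. \<forall>a\<in>D. \<forall>\<Delta>\<in>Pow D. 0 \<le> \<omega> x a \<Delta>)"

definition unitary :: "'x set \<Rightarrow> 'd set \<Rightarrow> ('x \<Rightarrow> 'd \<Rightarrow> 'd set \<Rightarrow> real) \<Rightarrow> bool" where
  "unitary X D \<omega> \<longleftrightarrow> (\<forall>x\<in>X. \<forall>\<Delta>\<in>Pow D. \<Delta> \<noteq> {} \<longrightarrow> (\<Sum>a\<in>\<Delta>. \<omega> x a \<Delta>) = 1)"

definition solution_weight ::
    "('x \<Rightarrow> 'd \<Rightarrow> 'd set \<Rightarrow> real) \<Rightarrow> ('x, 'd) csp \<Rightarrow> ('x \<Rightarrow> 'd) \<Rightarrow> 'x \<Rightarrow> real" where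
  "solution_weight \<omega> F \<sigma> x = \<omega> x (\<sigma> x) (available_values F \<sigma> x)"

definition instance_weight :: "('x \<Rightarrow> 'd \<Rightarrow> 'd set \<Rightarrow> real) \<Rightarrow> ('x, 'd) csp \<Rightarrow> real" where
  "instance_weight \<omega> F = (\<Sum>\<sigma>\<in>solutions F. \<Prod>x\<in>csp_vars F. solution_weight \<omega> F \<sigma> x)"

definition family_weight :: "('x \<Rightarrow> 'd \<Rightarrow> 'd set \<Rightarrow> real) \<Rightarrow> ('x, 'd) csp set \<Rightarrow> ennreal" where
  "family_weight \<omega> \<F> = (\<Sum>\<^sub>\<infinity>F\<in>\<F>. ennreal (instance_weight \<omega> F))"

definition renaming :: "'x set \<Rightarrow> 'd set \<Rightarrow> ('x \<Rightarrow> 'd \<Rightarrow> 'd) \<Rightarrow> bool" where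
  "renaming X D \<pi> \<longleftrightarrow> (\<forall>x\<in>X. \<pi> x permutes D)"

definition rename_constraint ::
    "('x \<Rightarrow> 'd \<Rightarrow> 'd) \<Rightarrow> ('x, 'd) constraint \<Rightarrow> ('x, 'd) constraint" where
  "rename_constraint \<pi> c = (fst c, (\<lambda>as. map2 \<pi> (fst c) as) ` snd c)"

definition rename_csp :: "('x \<Rightarrow> 'd \<Rightarrow> 'd) \<Rightarrow> ('x, 'd) csp \<Rightarrow> ('x, 'd) csp" where
  "rename_csp \<pi> F = \<lparr>csp_vars = csp_vars F, csp_dom = csp_dom F,
     csp_cons = rename_constraint \<pi> ` csp_cons F\<rparr>"

definition closed_under_renaming :: "('x, 'd) csp set \<Rightarrow> bool" where
  "closed_under_renaming \<F> \<longleftrightarrow>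
     (\<forall>F\<in>\<F>. \<forall>\<pi>. renaming (csp_vars F) (csp_dom F) \<pi> \<longrightarrow> rename_csp \<pi> F \<in> \<F>)"

text \<open>The library's strict linear orders require transitivity and irreflexivity on the whole
  type; together with the inclusion in \<open>D \<times> D\<close> this is a total strict order on \<open>D\<close>.\<close>

definition value_orders :: "'x set \<Rightarrow> 'd set \<Rightarrow> ('x \<Rightarrow> ('d \<times> 'd) set) \<Rightarrow> bool" where
  "value_orders X D lt \<longleftrightarrow> (\<forall>x\<in>X. lt x \<subseteq> D \<times> D \<and> strict_linear_order_on D (lt x))"

definition orientation ::
    "('x \<Rightarrow> ('d \<times> 'd) set) \<Rightarrow> ('x, 'd) csp \<Rightarrow> ('x \<Rightarrow> 'd) \<Rightarrow> ('x \<Rightarrow> 'd) \<Rightarrow> bool" where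
  "orientation lt F \<sigma> \<tau> \<longleftrightarrow> (\<exists>x\<in>csp_vars F. adjacent F x \<sigma> \<tau> \<and> (\<sigma> x, \<tau> x) \<in> lt x)"

definition minimal_solutions ::
    "('x \<Rightarrow> ('d \<times> 'd) set) \<Rightarrow> ('x, 'd) csp \<Rightarrow> ('x \<Rightarrow> 'd) set" where
  "minimal_solutions lt F =
     {\<sigma> \<in> solutions F. \<not> (\<exists>\<tau>\<in>solutions F. orientation lt F \<tau> \<sigma>)}"

end

theory Submission imports Defs begin

text \<open>Since \<open>\<F>\<close> is closed under renaming, its weight does not change if
  the weight of every instance is averaged over all renamings. In the average, the factor of
  a solution \<open>\<sigma>\<close> at a variable \<open>x\<close> becomes the mean of \<open>\<omega> x (\<pi> a) (\<pi> ` \<Delta>)\<close> over the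
  permutations \<open>\<pi>\<close> of \<open>D\<close>, where \<open>a = \<sigma> x\<close> and \<open>\<Delta>\<close> is the set of available values. By
  symmetry this mean is the same for all \<open>a \<in> \<Delta>\<close>, and unitarity then forces it to be
  \<open>1 / card \<Delta>\<close>. So \<open>\<gamma>(\<F>)\<close> is the same for all unitary generators; the minimal solutions are
  counted by the unitary generator that puts all its weight on the least element of \<open>\<Delta>\<close>.\<close>

section \<open>Averaging a unitary weight over the permutations of the domain\<close>

lemma sum_permutes_unitary:
  fixes f :: "'d \<Rightarrow> 'd set \<Rightarrow> real"
  assumes "finite D" "\<Delta> \<subseteq> D" "a \<in> \<Delta>"
    and unit: "\<And>\<Delta>. \<Delta> \<subseteq> D \<Longrightarrow> \<Delta> \<noteq> {} \<Longrightarrow> (\<Sum>b\<in>\<Delta>. f b \<Delta>) = 1"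
  shows "(\<Sum>p | p permutes D. f (p a) (p ` \<Delta>)) = fact (card D) / card \<Delta>"
proof -
  let ?S = "\<lambda>b. \<Sum>p | p permutes D. f (p b) (p ` \<Delta>)"
  have fin: "finite \<Delta>" using assms finite_subset by blast
  have sym: "?S b = ?S a" if "b \<in> \<Delta>" for b
  proof -
    have t: "transpose a b permutes D"
      using assms that by (intro permutes_swap_id) auto
    have "transpose a b ` \<Delta> = \<Delta>"
      using assms(3) that by simp
    then have im: "(p \<circ> transpose a b) ` \<Delta> = p ` \<Delta>" for p :: "'d \<Rightarrow> 'd"
      by (metis image_comp)
    have "?S a = (\<Sum>p | p permutes D. f ((p \<circ> transpose a b) a) ((p \<circ> transpose a b) ` \<Delta>))"
      by (rule sum_permutations_compose_right[OF t])
    also have "\<dots> = ?S b"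
      unfolding im by simp
    finally show ?thesis by simp
  qed
  have "card \<Delta> * ?S a = (\<Sum>b\<in>\<Delta>. ?S b)"
    using sym by simp
  also have "\<dots> = (\<Sum>p | p permutes D. \<Sum>b\<in>\<Delta>. f (p b) (p ` \<Delta>))"
    by (rule sum.swap)
  also have "\<dots> = (\<Sum>p | p permutes D. 1)"
  proof (rule sum.cong)
    fix p assume "p \<in> {p. p permutes D}"
    then have p: "p permutes D" by simp
    then have "inj_on p \<Delta>" by (meson permutes_inj inj_on_subset subset_UNIV)
    then have "(\<Sum>b\<in>\<Delta>. f (p b) (p ` \<Delta>)) = (\<Sum>b\<in>p ` \<Delta>. f b (p ` \<Delta>))"
      by (simp add: sum.reindex)
    also have "\<dots> = 1"
      using assms(2,3) permutes_image[OF p] by (intro unit) auto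
    finally show "(\<Sum>b\<in>\<Delta>. f (p b) (p ` \<Delta>)) = 1" .
  qed simp
  also have "\<dots> = fact (card D)"
    using assms(1) by (simp add: card_permutations)
  finally have "card \<Delta> * ?S a = fact (card D)" .
  moreover have "card \<Delta> \<noteq> 0"
    using fin assms(3) by auto
  ultimately show ?thesis
    by (simp add: eq_divide_eq mult.commute)
qed

section \<open>Action of renamings on valuations, instances and solutions\<close>

text \<open>The restriction to \<open>X\<close> keeps the result extensional, as membership in
  \<open>valuations\<close> demands.\<close>

definition rename_valuation :: "'x set \<Rightarrow> ('x \<Rightarrow> 'd \<Rightarrow> 'd) \<Rightarrow> ('x \<Rightarrow> 'd) \<Rightarrow> 'x \<Rightarrow> 'd" where
  "rename_valuation X \<pi> v = (\<lambda>x\<in>X. \<pi> x (v x))"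

lemma renaming_inv:
  "renaming X D \<pi> \<Longrightarrow> renaming X D (\<lambda>x. inv (\<pi> x))"
  by (simp add: renaming_def permutes_inv)

lemma bij_betw_rename_valuation:
  assumes "renaming X D \<pi>"
  shows "bij_betw (rename_valuation X \<pi>) (X \<rightarrow>\<^sub>E D) (X \<rightarrow>\<^sub>E D)"
proof -
  have p: "\<pi> x permutes D" if "x \<in> X" for x using assms that by (simp add: renaming_def)
  show ?thesis
    by (rule bij_betw_byWitness[where f' = "rename_valuation X (\<lambda>x. inv (\<pi> x))"])
      (auto simp: rename_valuation_def PiE_iff extensional_def fun_eq_iff
        permutes_inverses[OF p] permutes_in_image[OF p] permutes_in_image[OF permutes_inv[OF p]])
qed

lemma map2_inverse:
  assumes "\<And>x a. x \<in> set xs \<Longrightarrow> g x (f x a) = a" "length as = length xs"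
  shows "map2 g xs (map2 f xs as) = as"
  using assms by (auto intro!: nth_equalityI)

text \<open>Renaming tuples entrywise is invertible on tuples as long as the scope, so passing to
  the image of the relation adds no new preimages. The length condition matters because
  \<open>map2\<close> truncates.\<close>

lemma satisfies_rename:
  assumes \<pi>: "renaming X D \<pi>" and c: "wf_constraint X D c"
  shows "satisfies (rename_valuation X \<pi> v) (rename_constraint \<pi> c) \<longleftrightarrow> satisfies v c"
proof -
  have sub: "set (fst c) \<subseteq> X" and len: "\<And>as. as \<in> snd c \<Longrightarrow> length as = length (fst c)"
    using c by (auto simp: wf_constraint_def)
  have eq: "map (rename_valuation X \<pi> v) (fst c) = map2 \<pi> (fst c) (map v (fst c))"
    using subsetD[OF sub nth_mem] by (auto simp: rename_valuation_def intro!: nth_equalityI)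
  have inv: "map2 (\<lambda>x. inv (\<pi> x)) (fst c) (map2 \<pi> (fst c) as) = as"
    if "length as = length (fst c)" for as
    using \<pi> sub that
    by (intro map2_inverse) (auto simp: renaming_def intro!: permutes_inverses(2))
  have "map2 \<pi> (fst c) (map v (fst c)) \<in> map2 \<pi> (fst c) ` snd c \<longleftrightarrow> map v (fst c) \<in> snd c"
    using inv len by (metis (no_types, lifting) image_iff length_map)
  then show ?thesis
    by (simp add: satisfies_def rename_constraint_def eq)
qed

lemma rename_csp_simps [simp]:
  "csp_vars (rename_csp \<pi> F) = csp_vars F"
  "csp_dom (rename_csp \<pi> F) = csp_dom F"
  "csp_cons (rename_csp \<pi> F) = rename_constraint \<pi> ` csp_cons F"
  by (simp_all add: rename_csp_def)

lemma rename_csp_inverse: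
  assumes F: "csp_instance F"
    and inv: "\<And>x a. x \<in> csp_vars F \<Longrightarrow> \<rho> x (\<pi> x a) = a"
  shows "rename_csp \<rho> (rename_csp \<pi> F) = F"
proof -
  have "rename_constraint \<rho> (rename_constraint \<pi> c) = c" if "c \<in> csp_cons F" for c
  proof -
    have c: "wf_constraint (csp_vars F) (csp_dom F) c"
      using F that by (simp add: csp_instance_def)
    have "map2 \<rho> (fst c) (map2 \<pi> (fst c) as) = as" if "as \<in> snd c" for as
      using c that inv by (intro map2_inverse) (auto simp: wf_constraint_def)
    then show ?thesis
      by (simp add: rename_constraint_def image_image prod_eq_iff)
  qed
  then show ?thesis
    by (intro csp.equality) (simp_all add: image_image)
qed

text \<open>The inverse permutations form a renaming too, so closure applies in both directions and
  each renaming permutes the family.\<close>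

lemma bij_betw_rename_csp:
  assumes inst: "\<And>F. F \<in> \<F> \<Longrightarrow> csp_instance F \<and> csp_vars F = X \<and> csp_dom F = D"
    and closed: "closed_under_renaming \<F>" and \<pi>: "renaming X D \<pi>"
  shows "bij_betw (rename_csp \<pi>) \<F> \<F>"
proof (rule bij_betw_byWitness[where f' = "rename_csp (\<lambda>x. inv (\<pi> x))"])
  have p: "\<pi> x permutes D" if "x \<in> X" for x using \<pi> that by (simp add: renaming_def)
  show "\<forall>F\<in>\<F>. rename_csp (\<lambda>x. inv (\<pi> x)) (rename_csp \<pi> F) = F"
    using inst permutes_inverses(2)[OF p] by (auto intro!: rename_csp_inverse)
  show "\<forall>F\<in>\<F>. rename_csp \<pi> (rename_csp (\<lambda>x. inv (\<pi> x)) F) = F"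
    using inst permutes_inverses(1)[OF p] by (auto intro!: rename_csp_inverse)
  show "rename_csp \<pi> ` \<F> \<subseteq> \<F>" "rename_csp (\<lambda>x. inv (\<pi> x)) ` \<F> \<subseteq> \<F>"
    using closed inst \<pi> renaming_inv[OF \<pi>] by (auto simp: closed_under_renaming_def)
qed

lemma bij_betw_solutions_rename:
  assumes F: "csp_instance F" and \<pi>: "renaming (csp_vars F) (csp_dom F) \<pi>"
  shows "bij_betw (rename_valuation (csp_vars F) \<pi>) (solutions F) (solutions (rename_csp \<pi> F))"
proof -
  let ?r = "rename_valuation (csp_vars F) \<pi>"
  have bij: "bij_betw ?r (valuations F) (valuations F)"
    using bij_betw_rename_valuation[OF \<pi>] by (simp add: valuations_def)
  have sat: "(\<forall>c\<in>csp_cons F. satisfies (?r v) (rename_constraint \<pi> c)) \<longleftrightarrow>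
      (\<forall>c\<in>csp_cons F. satisfies v c)" for v
    using F satisfies_rename[OF \<pi>] by (auto simp: csp_instance_def)
  have val: "valuations (rename_csp \<pi> F) = ?r ` valuations F"
    unfolding bij_betw_imp_surj_on[OF bij] by (simp add: valuations_def)
  have "?r ` solutions F = solutions (rename_csp \<pi> F)"
    unfolding solutions_def val using sat by auto
  moreover have "inj_on ?r (solutions F)"
    using bij by (auto simp: bij_betw_def solutions_def intro: inj_on_subset)
  ultimately show ?thesis by (simp add: bij_betw_def)
qed

lemma adjacent_rename:
  assumes F: "csp_instance F" and \<pi>: "renaming (csp_vars F) (csp_dom F) \<pi>"
    and "\<sigma> \<in> solutions F" "\<tau> \<in> solutions F"
  shows "adjacent (rename_csp \<pi> F) x (rename_valuation (csp_vars F) \<pi> \<sigma>)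
      (rename_valuation (csp_vars F) \<pi> \<tau>) \<longleftrightarrow> adjacent F x \<sigma> \<tau>"
proof -
  have "inj (\<pi> y)" if "y \<in> csp_vars F" for y
    using \<pi> that by (auto simp: renaming_def permutes_inj)
  then show ?thesis
    using assms(3,4) bij_betw_imp_surj_on[OF bij_betw_solutions_rename[OF F \<pi>]]
    by (auto simp: adjacent_def rename_valuation_def inj_eq)
qed

text \<open>Every solution of the renamed instance is a renamed solution of \<open>F\<close>, and
  adjacency is preserved both ways because each \<open>\<pi> y\<close> is injective.\<close>

lemma available_values_rename:
  assumes F: "csp_instance F" and \<pi>: "renaming (csp_vars F) (csp_dom F) \<pi>"
    and \<sigma>: "\<sigma> \<in> solutions F" and x: "x \<in> csp_vars F"
  shows "available_values (rename_csp \<pi> F) (rename_valuation (csp_vars F) \<pi> \<sigma>) x =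
    \<pi> x ` available_values F \<sigma> x"
proof -
  let ?r = "rename_valuation (csp_vars F) \<pi>"
  have sol: "solutions (rename_csp \<pi> F) = ?r ` solutions F"
    using bij_betw_imp_surj_on[OF bij_betw_solutions_rename[OF F \<pi>]] by simp
  have "available_values (rename_csp \<pi> F) (?r \<sigma>) x =
      {\<tau> x | \<tau>. \<tau> \<in> ?r ` solutions F \<and> adjacent (rename_csp \<pi> F) x (?r \<sigma>) \<tau>}"
    unfolding available_values_def sol[symmetric] by (auto simp: adjacent_def)
  also have "\<dots> = {?r \<tau> x | \<tau>. \<tau> \<in> solutions F \<and> adjacent F x \<sigma> \<tau>}"
    using adjacent_rename[OF F \<pi> \<sigma>] by blast
  also have "\<dots> = \<pi> x ` available_values F \<sigma> x"
    using x by (auto simp: available_values_def rename_valuation_def adjacent_def)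
  finally show ?thesis .
qed

lemma instance_weight_rename:
  assumes F: "csp_instance F" and \<pi>: "renaming (csp_vars F) (csp_dom F) \<pi>"
  shows "instance_weight \<omega> (rename_csp \<pi> F) =
    (\<Sum>\<sigma>\<in>solutions F. \<Prod>x\<in>csp_vars F. \<omega> x (\<pi> x (\<sigma> x)) (\<pi> x ` available_values F \<sigma> x))"
  unfolding instance_weight_def
    sum.reindex_bij_betw[OF bij_betw_solutions_rename[OF F \<pi>], symmetric]
  by (intro sum.cong prod.cong)
    (simp_all add: solution_weight_def available_values_rename[OF F \<pi>], simp add: rename_valuation_def)

section \<open>Averaging the weight of a family over all renamings\<close>

lemma solutions_in_dom:
  "\<sigma> \<in> solutions F \<Longrightarrow> x \<in> csp_vars F \<Longrightarrow> \<sigma> x \<in> csp_dom F"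
  by (auto simp: solutions_def valuations_def)

lemma finite_solutions: "csp_instance F \<Longrightarrow> finite (solutions F)"
  by (simp add: csp_instance_def solutions_def valuations_def finite_PiE)

lemma available_values_subset: "x \<in> csp_vars F \<Longrightarrow> available_values F \<sigma> x \<subseteq> csp_dom F"
  by (auto simp: available_values_def adjacent_def solutions_in_dom)

lemma value_available: "\<sigma> \<in> solutions F \<Longrightarrow> \<sigma> x \<in> available_values F \<sigma> x"
  by (auto simp: available_values_def adjacent_def)

lemma instance_weight_nonneg:
  assumes "weight_generator (csp_vars F) (csp_dom F) \<omega>"
  shows "0 \<le> instance_weight \<omega> F"
  using assms available_values_subset[of _ F] solutions_in_dom[of _ F]
  by (auto simp: instance_weight_def solution_weight_def weight_generator_def
      intro!: sum_nonneg prod_nonneg)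

text \<open>The permutations at different variables are chosen independently, so the sum over
  renamings of a product is a product of sums over single permutations. The result no longer
  mentions \<open>\<omega>\<close>.\<close>

lemma sum_renamings_instance_weight:
  assumes F: "csp_instance F" "csp_vars F = X" "csp_dom F = D"
    and unit: "unitary X D \<omega>"
  shows "(\<Sum>\<pi>\<in>X \<rightarrow>\<^sub>E {p. p permutes D}. instance_weight \<omega> (rename_csp \<pi> F)) =
    (\<Sum>\<sigma>\<in>solutions F. \<Prod>x\<in>X. fact (card D) / card (available_values F \<sigma> x))"
proof -
  let ?A = "available_values F"
  have fin: "finite X" "finite D" using F by (auto simp: csp_instance_def)
  have "(\<Sum>\<pi>\<in>X \<rightarrow>\<^sub>E {p. p permutes D}. instance_weight \<omega> (rename_csp \<pi> F)) =
    (\<Sum>\<pi>\<in>X \<rightarrow>\<^sub>E {p. p permutes D}. \<Sum>\<sigma>\<in>solutions F. \<Prod>x\<in>X. \<omega> x (\<pi> x (\<sigma> x)) (\<pi> x ` ?A \<sigma> x))"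
    unfolding F(2,3)[symmetric] using F(1)
    by (intro sum.cong refl instance_weight_rename) (auto simp: renaming_def)
  also have "\<dots> =
    (\<Sum>\<sigma>\<in>solutions F. \<Prod>x\<in>X. \<Sum>p | p permutes D. \<omega> x (p (\<sigma> x)) (p ` ?A \<sigma> x))"
    using fin by (subst sum.swap) (simp add: prod_sum_PiE finite_permutations)
  also have "\<dots> = (\<Sum>\<sigma>\<in>solutions F. \<Prod>x\<in>X. fact (card D) / card (?A \<sigma> x))"
    using fin unit F available_values_subset[of _ F] value_available[of _ F]
    by (intro sum.cong prod.cong sum_permutes_unitary) (auto simp: unitary_def)
  finally show ?thesis .
qed

lemma sum_infsum_ennreal:
  fixes f :: "'i \<Rightarrow> 'a \<Rightarrow> ennreal"
  assumes "finite I"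
  shows "(\<Sum>i\<in>I. \<Sum>\<^sub>\<infinity>x\<in>A. f i x) = (\<Sum>\<^sub>\<infinity>x\<in>A. \<Sum>i\<in>I. f i x)"
  using assms
  by induction (simp_all add: infsum_add nonneg_summable_on_complete)

lemma family_weight_renamings:
  assumes fin: "finite X" "finite D"
    and inst: "\<And>F. F \<in> \<F> \<Longrightarrow> csp_instance F \<and> csp_vars F = X \<and> csp_dom F = D"
    and closed: "closed_under_renaming \<F>"
    and "weight_generator X D \<omega>" and unit: "unitary X D \<omega>"
  shows "of_nat (card (X \<rightarrow>\<^sub>E {p. p permutes D})) * family_weight \<omega> \<F> =
    (\<Sum>\<^sub>\<infinity>F\<in>\<F>. ennreal (\<Sum>\<sigma>\<in>solutions F. \<Prod>x\<in>X. fact (card D) / card (available_values F \<sigma> x)))"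
proof -
  \<comment> \<open>Extensional families represent each renaming once, which makes their number
    finite; \<open>renaming\<close> alone leaves \<open>\<pi>\<close> free outside
    \<open>X\<close>.\<close>
  let ?R = "X \<rightarrow>\<^sub>E {p. p permutes D}"
  have finR: "finite ?R"
    using fin by (simp add: finite_PiE finite_permutations)
  have "family_weight \<omega> \<F> = (\<Sum>\<^sub>\<infinity>F\<in>\<F>. ennreal (instance_weight \<omega> (rename_csp \<pi> F)))"
    if "\<pi> \<in> ?R" for \<pi>
    unfolding family_weight_def
    using that
    by (intro infsum_reindex_bij_betw[symmetric] bij_betw_rename_csp[OF inst closed])
      (auto simp: renaming_def)
  then have "(\<Sum>\<pi>\<in>?R. family_weight \<omega> \<F>) =
      (\<Sum>\<pi>\<in>?R. \<Sum>\<^sub>\<infinity>F\<in>\<F>. ennreal (instance_weight \<omega> (rename_csp \<pi> F)))"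
    by (rule sum.cong[OF refl])
  then have "of_nat (card ?R) * family_weight \<omega> \<F> =
      (\<Sum>\<pi>\<in>?R. \<Sum>\<^sub>\<infinity>F\<in>\<F>. ennreal (instance_weight \<omega> (rename_csp \<pi> F)))"
    by simp
  also have "\<dots> = (\<Sum>\<^sub>\<infinity>F\<in>\<F>. \<Sum>\<pi>\<in>?R. ennreal (instance_weight \<omega> (rename_csp \<pi> F)))"
    by (rule sum_infsum_ennreal[OF finR])
  also have "\<dots> = (\<Sum>\<^sub>\<infinity>F\<in>\<F>.
      ennreal (\<Sum>\<sigma>\<in>solutions F. \<Prod>x\<in>X. fact (card D) / card (available_values F \<sigma> x)))"
    \<comment> \<open>Nonnegativity of the weights lets \<open>ennreal\<close> commute with the
      finite sum over renamings.\<close>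
    using inst assms(5) sum_renamings_instance_weight[OF _ _ _ unit]
    by (intro infsum_cong) (simp add: instance_weight_nonneg)
  finally show ?thesis .
qed

lemma family_weight_unique:
  assumes "finite X" "finite D"
    and "\<And>F. F \<in> \<F> \<Longrightarrow> csp_instance F \<and> csp_vars F = X \<and> csp_dom F = D"
    and "closed_under_renaming \<F>"
    and "weight_generator X D \<omega>" "unitary X D \<omega>"
    and "weight_generator X D \<omega>'" "unitary X D \<omega>'"
  shows "family_weight \<omega> \<F> = family_weight \<omega>' \<F>"
proof -
  let ?R = "X \<rightarrow>\<^sub>E {p. p permutes D}"
  have "of_nat (card ?R) * family_weight \<omega> \<F> = of_nat (card ?R) * family_weight \<omega>' \<F>"
    using family_weight_renamings[OF assms(1-6)] family_weight_renamings[OF assms(1-4,7,8)]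
    by simp
  \<comment> \<open>The number of renamings is positive and finite, so it cancels even if the
    weights are infinite.\<close>
  moreover have "card ?R \<noteq> 0"
    using assms(1,2) by (simp add: card_PiE card_permutations)
  ultimately show ?thesis
    by (simp add: ennreal_mult_cancel_left)
qed

section \<open>The generator that counts minimal solutions\<close>

definition least_value_weight ::
    "('x \<Rightarrow> ('d \<times> 'd) set) \<Rightarrow> 'x \<Rightarrow> 'd \<Rightarrow> 'd set \<Rightarrow> real" where
  "least_value_weight lt x a \<Delta> = (if \<forall>b\<in>\<Delta>. (b, a) \<notin> lt x then 1 else 0)"

lemma unitary_least_value_weight:
  assumes "finite D" "value_orders X D lt"
  shows "unitary X D (least_value_weight lt)"
  unfolding unitary_def
proof (intro ballI impI)
  fix x \<Delta> assume x: "x \<in> X" and \<Delta>: "\<Delta> \<in> Pow D" "\<Delta> \<noteq> {}"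
  have lt: "trans (lt x)" "irrefl (lt x)" "total_on D (lt x)"
    using assms(2) x by (auto simp: value_orders_def strict_linear_order_on_def)
  have fin: "finite \<Delta>" using \<Delta>(1) assms(1) finite_subset by blast
  \<comment> \<open>A finite acyclic relation is well-founded, which yields a minimal element
    \<open>a\<close> of \<open>\<Delta>\<close>.\<close>
  have "finite (lt x)"
    using assms x by (auto simp: value_orders_def intro: finite_subset[of _ "D \<times> D"])
  moreover have "acyclic (lt x)"
    using lt by (simp add: acyclic_irrefl)
  ultimately have "wf (lt x)"
    by (rule finite_acyclic_wf)
  then obtain a where a: "a \<in> \<Delta>" "\<forall>b\<in>\<Delta>. (b, a) \<notin> lt x"
    using \<Delta>(2) by (metis ex_in_conv wfE_min)
  \<comment> \<open>Totality makes the minimal element unique: any other \<open>b\<close> is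
    comparable with \<open>a\<close>, and \<open>b\<close> below \<open>a\<close> is
    excluded.\<close>
  have "(\<forall>c\<in>\<Delta>. (c, b) \<notin> lt x) \<longleftrightarrow> b = a" if "b \<in> \<Delta>" for b
    using that a \<Delta>(1) lt(3) unfolding total_on_def by blast
  then have "(\<Sum>b\<in>\<Delta>. least_value_weight lt x b \<Delta>) = (\<Sum>b\<in>\<Delta>. if b = a then 1 else 0)"
    by (intro sum.cong) (auto simp: least_value_weight_def)
  also have "\<dots> = 1"
    using fin a(1) by simp
  finally show "(\<Sum>b\<in>\<Delta>. least_value_weight lt x b \<Delta>) = 1" .
qed

text \<open>Minimality splits into one condition per variable, involving only the available values,
  which is what a product of weights can test.\<close>

lemma minimal_solutions_iff:
  "\<sigma> \<in> minimal_solutions lt F \<longleftrightarrow> \<sigma> \<in> solutions F \<and>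
     (\<forall>x\<in>csp_vars F. \<forall>b\<in>available_values F \<sigma> x. (b, \<sigma> x) \<notin> lt x)"
proof -
  have "adjacent F x \<tau> \<sigma> \<longleftrightarrow> adjacent F x \<sigma> \<tau>" for x \<tau>
    unfolding adjacent_def by metis
  then have "(\<exists>\<tau>\<in>solutions F. orientation lt F \<tau> \<sigma>) \<longleftrightarrow>
      (\<exists>x\<in>csp_vars F. \<exists>\<tau>. adjacent F x \<sigma> \<tau> \<and> (\<tau> x, \<sigma> x) \<in> lt x)"
    unfolding orientation_def by (meson adjacent_def)
  also have "\<dots> \<longleftrightarrow> (\<exists>x\<in>csp_vars F. \<exists>b\<in>available_values F \<sigma> x. (b, \<sigma> x) \<in> lt x)"
    unfolding available_values_def by blast
  finally show ?thesis
    unfolding minimal_solutions_def by blast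
qed

text \<open>All factors are 0 or 1, so the product over the variables is the indicator of
  minimality.\<close>

lemma instance_weight_least_value:
  assumes F: "csp_instance F"
  shows "instance_weight (least_value_weight lt) F = card (minimal_solutions lt F)"
proof -
  have fin: "finite (csp_vars F)" using F by (simp add: csp_instance_def)
  have "instance_weight (least_value_weight lt) F =
      (\<Sum>\<sigma>\<in>solutions F. if \<sigma> \<in> minimal_solutions lt F then 1 else 0)"
    unfolding instance_weight_def
  proof (rule sum.cong)
    fix \<sigma> assume "\<sigma> \<in> solutions F"
    then show "(\<Prod>x\<in>csp_vars F. solution_weight (least_value_weight lt) F \<sigma> x) =
        (if \<sigma> \<in> minimal_solutions lt F then 1 else 0)"
      using fin
      by (auto simp: minimal_solutions_iff solution_weight_def least_value_weight_def)
  qed simp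
  also have "\<dots> = card (minimal_solutions lt F)"
    using finite_solutions[OF F]
    by (simp add: sum.If_cases) (simp add: minimal_solutions_def Int_def conj_commute)
  finally show ?thesis .
qed

theorem theorem38:
  fixes X :: "'x set" and D :: "'d set" and \<F> :: "('x, 'd) csp set"
    and \<omega> :: "'x \<Rightarrow> 'd \<Rightarrow> 'd set \<Rightarrow> real"
    and lt :: "'x \<Rightarrow> ('d \<times> 'd) set"
  assumes "finite X" and "finite D"
    and "\<And>F. F \<in> \<F> \<Longrightarrow> csp_instance F \<and> csp_vars F = X \<and> csp_dom F = D"
    and "closed_under_renaming \<F>"
    and "weight_generator X D \<omega>" and "unitary X D \<omega>"
    and "value_orders X D lt"
  shows "(\<Sum>\<^sub>\<infinity>F\<in>\<F>. of_nat (card (minimal_solutions lt F))) = family_weight \<omega> \<F>"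
proof -
  have "(\<Sum>\<^sub>\<infinity>F\<in>\<F>. of_nat (card (minimal_solutions lt F))) =
      family_weight (least_value_weight lt) \<F>"
    unfolding family_weight_def using assms(3)
    by (intro infsum_cong) (simp add: instance_weight_least_value ennreal_of_nat_eq_real_of_nat)
  also have "weight_generator X D (least_value_weight lt)"
    by (simp add: weight_generator_def least_value_weight_def)
  then have "family_weight (least_value_weight lt) \<F> = family_weight \<omega> \<F>"
    by (intro family_weight_unique[OF assms(1-4)] unitary_least_value_weight assms)
  finally show ?thesis .
qed

end
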